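(* Let $F_X$ be a free group with finite basis $X$ and let $U,V$ be rational subsets of $F_X$. Then $\mathrm{ConjGeo}_X(U,V)$ and $\mathrm{ConjMinLenSL}_X(U,V)$ are regular languages.
   Context: Let $G$ be a group with finite generating set $X\subseteq G$, let $\widetilde X=X\cup X^{-1}$ and let $\pi:\widetilde X^*\to G$ be the canonical surjective monoid homomorphism. For $g\in G$, $|g|$ is the length of a shortest word over $\widetilde X$ representing $g$, and $|g|_c=\min\{|h| : h \text{ conjugate to } g\}$; $\ell(w)$ is the length of a word $w$. Fix a total order on $\widetilde X$; $w_g$ denotes the shortlex-least word in $\widetilde X^*$ representing $g$. For $U,V\subseteq G$ put $\alpha(U,V)=\bigcup_{v\in V}v^{-1}Uv$, and $$\mathrm{ConjGeo}_X(U,V)=\{w\in\widetilde X^* : \ell(w)=|w\pi|_c \text{ and } w\pi\in\alpha(U,V)\},$$ $$\mathrm{ConjMinLenSL}_X(U,V)=\{w_g : g\in\alpha(U,V),\ |g|=|g|_c\}.$$ A subset $U\subseteq G$ is rational if there is a regular language $L\subseteq\widetilde X^*$ with $L\pi=U$. Here $G=F_X$. *)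

theory Defs
  imports "HOL-Algebra.Generated_Groups"
begin

section \<open>Words over a generating set\<close>

definition sym_gens :: "('a, 'b) monoid_scheme \<Rightarrow> 'a set \<Rightarrow> 'a set" where
  "sym_gens G X = X \<union> (\<lambda>x. inv\<^bsub>G\<^esub> x) ` X"

definition word_val :: "('a, 'b) monoid_scheme \<Rightarrow> 'a list \<Rightarrow> 'a" where
  "word_val G w = foldr (\<lambda>x y. x \<otimes>\<^bsub>G\<^esub> y) w \<one>\<^bsub>G\<^esub>"

definition word_length :: "('a, 'b) monoid_scheme \<Rightarrow> 'a set \<Rightarrow> 'a \<Rightarrow> nat" where
  "word_length G X g =
    (LEAST n. \<exists>w \<in> lists (sym_gens G X). word_val G w = g \<and> length w = n)"

definition conjugate :: "('a, 'b) monoid_scheme \<Rightarrow> 'a \<Rightarrow> 'a \<Rightarrow> bool" where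
  "conjugate G h g \<longleftrightarrow> (\<exists>x \<in> carrier G. h = inv\<^bsub>G\<^esub> x \<otimes>\<^bsub>G\<^esub> g \<otimes>\<^bsub>G\<^esub> x)"

definition conj_length :: "('a, 'b) monoid_scheme \<Rightarrow> 'a set \<Rightarrow> 'a \<Rightarrow> nat" where
  "conj_length G X g = (LEAST n. \<exists>h. conjugate G h g \<and> word_length G X h = n)"

text \<open>The order \<open>R\<close> on the letters is reflexive, whereas \<^const>\<open>lenlex\<close> expects a strict one.\<close>

definition shortlex_rep :: "('a, 'b) monoid_scheme \<Rightarrow> 'a set \<Rightarrow> 'a rel \<Rightarrow> 'a \<Rightarrow> 'a list" where
  "shortlex_rep G X R g =
    (THE w. w \<in> lists (sym_gens G X) \<and> word_val G w = g \<and>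
       (\<forall>w' \<in> lists (sym_gens G X). word_val G w' = g \<longrightarrow> w' \<noteq> w \<longrightarrow> (w, w') \<in> lenlex (R - Id)))"

definition alpha :: "('a, 'b) monoid_scheme \<Rightarrow> 'a set \<Rightarrow> 'a set \<Rightarrow> 'a set" where
  "alpha G U V = (\<Union>v \<in> V. (\<lambda>u. inv\<^bsub>G\<^esub> v \<otimes>\<^bsub>G\<^esub> u \<otimes>\<^bsub>G\<^esub> v) ` U)"

definition ConjGeo :: "('a, 'b) monoid_scheme \<Rightarrow> 'a set \<Rightarrow> 'a set \<Rightarrow> 'a set \<Rightarrow> 'a list set" where
  "ConjGeo G X U V =
    {w \<in> lists (sym_gens G X).
       length w = conj_length G X (word_val G w) \<and> word_val G w \<in> alpha G U V}"

definition ConjMinLenSL ::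
    "('a, 'b) monoid_scheme \<Rightarrow> 'a set \<Rightarrow> 'a rel \<Rightarrow> 'a set \<Rightarrow> 'a set \<Rightarrow> 'a list set" where
  "ConjMinLenSL G X R U V =
    {shortlex_rep G X R g | g. g \<in> alpha G U V \<and> word_length G X g = conj_length G X g}"


section \<open>Regular languages and rational subsets\<close>

text \<open>
  Acceptance by a complete deterministic finite automaton over the alphabet \<open>A\<close>. Only
  finiteness of the state set \<open>Q\<close> matters, so naturals as states are no restriction.
\<close>

definition regular_language :: "'a set \<Rightarrow> 'a list set \<Rightarrow> bool" where
  "regular_language A L \<longleftrightarrow> finite A \<and>
    (\<exists>(Q :: nat set) q0 F \<delta>. finite Q \<and> q0 \<in> Q \<and> F \<subseteq> Q \<and>
       (\<forall>q \<in> Q. \<forall>a \<in> A. \<delta> q a \<in> Q) \<and>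
       L = {w \<in> lists A. foldl \<delta> q0 w \<in> F})"

definition rational_subset :: "('a, 'b) monoid_scheme \<Rightarrow> 'a set \<Rightarrow> 'a set \<Rightarrow> bool" where
  "rational_subset G X U \<longleftrightarrow>
    (\<exists>L. regular_language (sym_gens G X) L \<and> word_val G ` L = U)"


section \<open>Free groups\<close>

text \<open>
  A free group on \<open>X\<close> is the quotient of the free monoid on \<open>X\<close> and a disjoint copy of formal
  inverses, by the congruence generated by the cancellations of a letter with its inverse.
  The letter \<open>(x, True)\<close> stands for \<open>x\<close> and \<open>(x, False)\<close> for its formal inverse; the letters
  have to be formal, since in \<^const>\<open>sym_gens\<close> a generator may coincide with the inverse of a
  generator unless \<open>X\<close> is already known to be a basis.
\<close>

inductive free_cancel :: "'a set \<Rightarrow> ('a \<times> bool) list \<Rightarrow> ('a \<times> bool) list \<Rightarrow> bool" for X where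
  "x \<in> X \<Longrightarrow> free_cancel X (u @ [(x, b), (x, \<not> b)] @ v) (u @ v)"

definition free_equiv :: "'a set \<Rightarrow> ('a \<times> bool) list \<Rightarrow> ('a \<times> bool) list \<Rightarrow> bool" where
  "free_equiv X = equivclp (free_cancel X)"

definition formal_val ::
    "('h, 'b) monoid_scheme \<Rightarrow> ('a \<Rightarrow> 'h) \<Rightarrow> ('a \<times> bool) list \<Rightarrow> 'h" where
  "formal_val H f w = word_val H (map (\<lambda>(x, b). if b then f x else inv\<^bsub>H\<^esub> (f x)) w)"

text \<open>
  \<open>G\<close> is free with basis \<open>X\<close>: the evaluation of formal words induces an isomorphism from the
  quotient above onto \<open>G\<close>. The universal property is derived below.
\<close>

definition free_group_basis :: "('a, 'b) monoid_scheme \<Rightarrow> 'a set \<Rightarrow> bool" where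
  "free_group_basis G X \<longleftrightarrow>
    group G \<and> X \<subseteq> carrier G \<and> generate G X = carrier G \<and>
    (\<forall>u \<in> lists (X \<times> UNIV). \<forall>v \<in> lists (X \<times> UNIV).
       formal_val G (\<lambda>x. x) u = formal_val G (\<lambda>x. x) v \<longleftrightarrow> free_equiv X u v)"

lemma formal_val_Nil [simp]: "formal_val H f [] = \<one>\<^bsub>H\<^esub>"
  by (simp add: formal_val_def word_val_def)

lemma formal_val_Cons [simp]:
  "formal_val H f (a # w) =
    (if snd a then f (fst a) else inv\<^bsub>H\<^esub> (f (fst a))) \<otimes>\<^bsub>H\<^esub> formal_val H f w"
  by (simp add: formal_val_def word_val_def case_prod_beta)

context group
begin

lemma formal_val_closed:
  "\<lbrakk>f \<in> X \<rightarrow> carrier G; w \<in> lists (X \<times> UNIV)\<rbrakk> \<Longrightarrow> formal_val G f w \<in> carrier G"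
  by (induction w) (auto simp: Pi_iff)

lemma formal_val_append:
  assumes "f \<in> X \<rightarrow> carrier G" "u \<in> lists (X \<times> UNIV)" "v \<in> lists (X \<times> UNIV)"
  shows "formal_val G f (u @ v) = formal_val G f u \<otimes> formal_val G f v"
  using assms(2)
proof (induction u)
  case Nil
  then show ?case using formal_val_closed[OF assms(1,3)] by simp
next
  case (Cons a u)
  moreover have "f (fst a) \<in> carrier G" using Cons assms(1) by auto
  ultimately show ?case
    using formal_val_closed[OF assms(1)] assms(3) by (auto simp: m_assoc)
qed

lemma formal_val_cancel:
  assumes f: "f \<in> X \<rightarrow> carrier G" and c: "free_cancel X u v"
  shows "u \<in> lists (X \<times> UNIV) \<longleftrightarrow> v \<in> lists (X \<times> UNIV)"
    and "u \<in> lists (X \<times> UNIV) \<Longrightarrow> formal_val G f u = formal_val G f v"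
proof -
  obtain x b p q where uv: "x \<in> X" "u = p @ [(x, b), (x, \<not> b)] @ q" "v = p @ q"
    using c by cases auto
  show 1: "u \<in> lists (X \<times> UNIV) \<longleftrightarrow> v \<in> lists (X \<times> UNIV)"
    using uv by auto
  assume "u \<in> lists (X \<times> UNIV)"
  then have p: "p \<in> lists (X \<times> UNIV)" and q: "q \<in> lists (X \<times> UNIV)" using uv by auto
  have fx: "f x \<in> carrier G" using uv f by auto
  have qc: "formal_val G f q \<in> carrier G" using formal_val_closed[OF f q] .
  have "formal_val G f ([(x, b), (x, \<not> b)] @ q) = formal_val G f q"
    using fx qc by (cases b) (auto simp: m_assoc[symmetric])
  moreover have "[(x, b), (x, \<not> b)] @ q \<in> lists (X \<times> UNIV)" using q uv by auto
  ultimately show "formal_val G f u = formal_val G f v"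
    using formal_val_append[OF f p] q uv by metis
qed

lemma formal_val_equiv:
  assumes f: "f \<in> X \<rightarrow> carrier G" and e: "free_equiv X u v" and u: "u \<in> lists (X \<times> UNIV)"
  shows "v \<in> lists (X \<times> UNIV) \<and> formal_val G f u = formal_val G f v"
  using e unfolding free_equiv_def
proof (induction rule: equivclp_induct)
  case base
  then show ?case using u by simp
next
  case (step y z)
  then show ?case using formal_val_cancel[OF f] by metis
qed

lemma formal_val_surj:
  assumes X: "X \<subseteq> carrier G" and g: "g \<in> generate G X"
  shows "\<exists>w \<in> lists (X \<times> UNIV). formal_val G (\<lambda>x. x) w = g"
  using g
proof (induction rule: generate.induct)
  case one
  show ?case by (rule bexI[of _ "[]"]) auto
next
  case (incl h)
  show ?case by (rule bexI[of _ "[(h, True)]"]) (use incl X in auto)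
next
  case (inv h)
  show ?case by (rule bexI[of _ "[(h, False)]"]) (use inv X in auto)
next
  case (eng h1 h2)
  then obtain u v where u: "u \<in> lists (X \<times> UNIV)" "formal_val G (\<lambda>x. x) u = h1"
    and v: "v \<in> lists (X \<times> UNIV)" "formal_val G (\<lambda>x. x) v = h2" by blast
  have "(\<lambda>x. x) \<in> X \<rightarrow> carrier G" using X by auto
  from formal_val_append[OF this u(1) v(1)] u v show ?case
    by (intro bexI[of _ "u @ v"]) auto
qed

end

text \<open>Uniqueness of the extension is clear, as \<open>X\<close> generates \<open>G\<close>.\<close>

lemma free_group_basis_universal:
  assumes G: "free_group_basis G X" and H: "group H" and f: "f \<in> X \<rightarrow> carrier H"
  shows "\<exists>h \<in> hom G H. \<forall>x \<in> X. h x = f x"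
proof -
  interpret G: group G using G by (simp add: free_group_basis_def)
  interpret H: group H by (rule H)
  let ?W = "lists (X \<times> (UNIV :: bool set))"
  have X: "X \<subseteq> carrier G" and gen: "generate G X = carrier G"
    and eq: "\<And>u v. \<lbrakk>u \<in> ?W; v \<in> ?W; formal_val G (\<lambda>x. x) u = formal_val G (\<lambda>x. x) v\<rbrakk>
      \<Longrightarrow> free_equiv X u v"
    using G by (auto simp: free_group_basis_def)
  have id: "(\<lambda>x. x) \<in> X \<rightarrow> carrier G" using X by auto
  define rep where "rep g = (SOME w. w \<in> ?W \<and> formal_val G (\<lambda>x. x) w = g)" for g
  have rep: "rep g \<in> ?W \<and> formal_val G (\<lambda>x. x) (rep g) = g" if "g \<in> carrier G" for g
    unfolding rep_def by (rule someI_ex) (use G.formal_val_surj[OF X] that gen in blast)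
  define h where "h g = formal_val H f (rep g)" for g
  have h: "h (formal_val G (\<lambda>x. x) w) = formal_val H f w" if "w \<in> ?W" for w
    unfolding h_def using H.formal_val_equiv[OF f] eq rep G.formal_val_closed[OF id that] that
    by metis
  have "h \<in> hom G H"
  proof (rule homI)
    fix a b assume ab: "a \<in> carrier G" "b \<in> carrier G"
    show "h a \<in> carrier H" unfolding h_def using rep ab H.formal_val_closed[OF f] by blast
    have "h (a \<otimes>\<^bsub>G\<^esub> b) = formal_val H f (rep a @ rep b)"
      using h[of "rep a @ rep b"] rep ab G.formal_val_append[OF id] by auto
    then show "h (a \<otimes>\<^bsub>G\<^esub> b) = h a \<otimes>\<^bsub>H\<^esub> h b"
      unfolding h_def using H.formal_val_append[OF f] rep ab by simp
  qed
  moreover have "h x = f x" if "x \<in> X" for x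
    using h[of "[(x, True)]"] that X f by (auto simp: Pi_iff subset_iff)
  ultimately show ?thesis by blast
qed

end

theory Submission
  imports Defs
begin

text \<open>
  In a free group the geodesic words are the reduced words, one for each element, and the words of
  minimal length in their conjugacy class are the cyclically reduced ones. Hence both languages
  consist of the cyclically reduced words \<open>w\<close> with value in \<open>\<alpha>(U, V)\<close>.

  Let \<open>v\<close> be reduced and \<open>w\<close> be cyclically reduced and nonempty. Stripping powers of \<open>w\<close> or of
  its inverse from the end of \<open>v\<close> gives \<open>w = q p\<close> and \<open>v = s p w^n\<close> or \<open>v = s q^{-1} w^{-n}\<close>
  such that \<open>s p q s^{-1}\<close>, which represents \<open>v w v^{-1}\<close>, is reduced. For an automaton let a word
  \<open>w\<close> act on the states by all runs along words with the same value as \<open>w\<close>. This action is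
  multiplicative on reduced products, and so whether the value of \<open>w\<close> lies in \<open>\<alpha>(U, V)\<close> depends
  only on the finitely many possible pairs of actions of \<open>q\<close> and \<open>p\<close>, over all factorizations
  \<open>w = q p\<close>. The set of these pairs is a right invariant of \<open>w\<close> with finitely many values.
\<close>

declare in_listsI [rule del] in_listsD [rule del]

section \<open>Regularity from a finite right invariant\<close>

text \<open>The easy half of the Myhill-Nerode theorem: the values of \<open>f\<close>, numbered by
  \<open>e\<close>, serve as states, with the value at \<open>[]\<close> initial and the values on
  \<open>L\<close> accepting.\<close>

lemma regular_language_finite_invariant:
  assumes A: "finite A" and fin: "finite (f ` lists A)" and L: "L \<subseteq> lists A"
    and step: "\<And>w w' a. \<lbrakk>w \<in> lists A; w' \<in> lists A; a \<in> A; f w = f w'\<rbrakk>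
      \<Longrightarrow> f (w @ [a]) = f (w' @ [a])"
    and mem: "\<And>w w'. \<lbrakk>w \<in> L; w' \<in> lists A; f w = f w'\<rbrakk> \<Longrightarrow> w' \<in> L"
  shows "regular_language A L"
proof -
  obtain e :: "_ \<Rightarrow> nat" where e: "inj_on e (f ` lists A)"
    using finite_imp_inj_to_nat_seg[OF fin] by blast
  define g where "g w = e (f w)" for w
  have g_eq: "f w = f w'" if "g w = g w'" "w \<in> lists A" "w' \<in> lists A" for w w'
    using that inj_onD[OF e, of "f w" "f w'"] by (simp add: g_def)
  \<comment> \<open>Any word reaching the state \<open>q\<close> may stand in for it: by
    \<open>step\<close> the successor does not depend on the choice.\<close>
  define \<delta> where "\<delta> q a = g ((SOME w. w \<in> lists A \<and> g w = q) @ [a])" for q a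
  have delta: "\<delta> (g w) a = g (w @ [a])" if "w \<in> lists A" "a \<in> A" for w a
  proof -
    define v where "v = (SOME v. v \<in> lists A \<and> g v = g w)"
    have v: "v \<in> lists A \<and> g v = g w"
      unfolding v_def by (rule someI[of _ w]) (use that in simp)
    then have "f (v @ [a]) = f (w @ [a])"
      using step[of v w a] g_eq[of v w] that by blast
    then show ?thesis by (simp add: \<delta>_def g_def v_def)
  qed
  have run: "foldl \<delta> (g []) w = g w" if "w \<in> lists A" for w
    using that by (induction w rule: rev_induct) (auto simp: delta)
  have "L = {w \<in> lists A. foldl \<delta> (g []) w \<in> g ` L}"
  proof (intro Set.set_eqI iffI)
    fix w assume "w \<in> L"
    then show "w \<in> {w \<in> lists A. foldl \<delta> (g []) w \<in> g ` L}" using L run by auto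
  next
    fix w assume w: "w \<in> {w \<in> lists A. foldl \<delta> (g []) w \<in> g ` L}"
    then obtain v where "v \<in> L" "g v = g w" using run by auto
    then show "w \<in> L" using mem g_eq L w by (metis (no_types, lifting) mem_Collect_eq subsetD)
  qed
  moreover have "finite (g ` lists A)"
    using finite_imageI[OF fin, of e] by (simp add: g_def image_image)
  moreover have "\<forall>q \<in> g ` lists A. \<forall>a \<in> A. \<delta> q a \<in> g ` lists A" by (auto simp: delta)
  ultimately show ?thesis
    unfolding regular_language_def using A L
    by (intro conjI exI[of _ "g ` lists A"] exI[of _ "g []"] exI[of _ "g ` L"] exI[of _ \<delta>])
      auto
qed


section \<open>Uniqueness of reduced formal words\<close>

definition formal_reduced :: "('a \<times> bool) list \<Rightarrow> bool" where
  "formal_reduced = successively (\<lambda>a b. b \<noteq> (fst a, \<not> snd a))"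

text \<open>Left multiplication by a letter on reduced words, as in van der Waerden's construction
  of free groups.\<close>

definition cancel_Cons :: "'a \<times> bool \<Rightarrow> ('a \<times> bool) list \<Rightarrow> ('a \<times> bool) list" where
  "cancel_Cons a w =
    (if w \<noteq> [] \<and> hd w = (fst a, \<not> snd a) then tl w else a # w)"

lemma formal_reduced_cancel_Cons: "formal_reduced w \<Longrightarrow> formal_reduced (cancel_Cons a w)"
  by (cases w) (auto simp: formal_reduced_def cancel_Cons_def successively_Cons)

text \<open>If \<open>w\<close> starts with \<open>(x, b)\<close>, the inner call removes that
  letter and the outer one restores it, since in a reduced word the next letter is not
  \<open>(x, \<not> b)\<close>. Thus letters act on reduced words by permutations.\<close>

lemma cancel_Cons_inverse:
  "formal_reduced w \<Longrightarrow> cancel_Cons (x, b) (cancel_Cons (x, \<not> b) w) = w"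
  by (cases w) (auto simp: formal_reduced_def cancel_Cons_def successively_Cons)

lemma formal_reduced_foldr: "formal_reduced (foldr cancel_Cons w [])"
  by (induction w) (auto simp: formal_reduced_cancel_Cons, simp add: formal_reduced_def)

lemma foldr_cancel_Cons_reduced: "formal_reduced w \<Longrightarrow> foldr cancel_Cons w [] = w"
  by (induction w) (auto simp: formal_reduced_def cancel_Cons_def successively_Cons)

text \<open>A cancelling pair acts trivially, so the image of \<open>[]\<close> under the action is
  constant on equivalence classes. This gives uniqueness of reduced forms without a confluence
  argument.\<close>

lemma foldr_cancel_Cons_equiv:
  assumes "free_equiv X u v"
  shows "foldr cancel_Cons u [] = foldr cancel_Cons v []"
proof -
  have *: "foldr cancel_Cons u [] = foldr cancel_Cons v []" if "free_cancel X u v" for u v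
    using that by cases (simp add: cancel_Cons_inverse formal_reduced_foldr)
  show ?thesis
    using assms unfolding free_equiv_def by (induction rule: equivclp_induct) (auto dest: *)
qed

lemma formal_reduced_unique:
  "\<lbrakk>free_equiv X u v; formal_reduced u; formal_reduced v\<rbrakk> \<Longrightarrow> u = v"
  using foldr_cancel_Cons_equiv foldr_cancel_Cons_reduced by metis


section \<open>Reduced words in a free group\<close>

locale free_group_with_basis = group G for G :: "('a, 'b) monoid_scheme" (structure) +
  fixes X :: "'a set"
  assumes basis: "free_group_basis G X"
begin

abbreviation "A \<equiv> sym_gens G X"
abbreviation "val \<equiv> word_val G"

definition reduced :: "'a list \<Rightarrow> bool" where
  "reduced = successively (\<lambda>a b. b \<noteq> inv a)"

definition winv :: "'a list \<Rightarrow> 'a list" where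
  "winv w = rev (map (\<lambda>a. inv a) w)"

definition wpow :: "nat \<Rightarrow> 'a list \<Rightarrow> 'a list" where
  "wpow n w = concat (replicate n w)"

lemma X_carrier: "X \<subseteq> carrier G"
  using basis by (simp add: free_group_basis_def)

lemma letter_carrier [simp]: "a \<in> A \<Longrightarrow> a \<in> carrier G"
  using X_carrier by (auto simp: sym_gens_def)

lemma inv_letter [simp]: "a \<in> A \<Longrightarrow> inv a \<in> A"
  using X_carrier by (auto simp: sym_gens_def)

lemma val_Nil [simp]: "val [] = \<one>" and val_Cons [simp]: "val (a # w) = a \<otimes> val w"
  by (simp_all add: word_val_def)

lemma val_closed [simp]: "w \<in> lists A \<Longrightarrow> val w \<in> carrier G"
  by (induction w) auto

lemma val_append [simp]:
  "\<lbrakk>u \<in> lists A; v \<in> lists A\<rbrakk> \<Longrightarrow> val (u @ v) = val u \<otimes> val v"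
  by (induction u) (auto simp: m_assoc)

lemma winv_lists [simp]: "w \<in> lists A \<Longrightarrow> winv w \<in> lists A"
  by (auto simp: winv_def in_lists_conv_set)

lemma winv_Nil [simp]: "winv [] = []"
  and winv_Cons: "winv (a # w) = winv w @ [inv a]"
  and winv_append [simp]: "winv (u @ v) = winv v @ winv u"
  and winv_eq_Nil [simp]: "winv w = [] \<longleftrightarrow> w = []"
  by (simp_all add: winv_def)

lemma winv_winv [simp]: "w \<in> lists A \<Longrightarrow> winv (winv w) = w"
  by (induction w rule: list.induct) (auto simp: winv_Cons)

lemma hd_winv: "w \<noteq> [] \<Longrightarrow> hd (winv w) = inv (last w)"
  by (simp add: winv_def hd_rev last_map)

lemma val_winv [simp]: "w \<in> lists A \<Longrightarrow> val (winv w) = inv (val w)"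
  by (induction w) (auto simp: winv_Cons inv_mult_group)

lemma wpow_lists [simp]: "w \<in> lists A \<Longrightarrow> wpow n w \<in> lists A"
  by (induction n) (auto simp: wpow_def)

lemma wpow_0 [simp]: "wpow 0 w = []"
  by (simp add: wpow_def)

lemma wpow_Suc: "wpow (Suc n) w = wpow n w @ w"
  unfolding wpow_def
  by (metis concat.simps(1,2) concat_append append_Nil2 replicate_Suc replicate_append_same)

lemma val_wpow [simp]: "w \<in> lists A \<Longrightarrow> val (wpow n w) = val w [^] n"
  by (induction n) (auto simp: wpow_Suc)

lemma reduced_append_iff:
  "reduced (u @ v) \<longleftrightarrow>
    reduced u \<and> reduced v \<and> (u = [] \<or> v = [] \<or> hd v \<noteq> inv (last u))"
  by (auto simp: reduced_def successively_append_iff)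

lemma reduced_Nil [simp]: "reduced []" and reduced_single [simp]: "reduced [a]"
  by (simp_all add: reduced_def)

lemma reduced_Cons: "reduced (a # w) \<longleftrightarrow> reduced w \<and> (w = [] \<or> hd w \<noteq> inv a)"
  by (auto simp: reduced_def successively_Cons)

lemma reduced_winv: "\<lbrakk>w \<in> lists A; reduced w\<rbrakk> \<Longrightarrow> reduced (winv w)"
proof (induction w)
  case (Cons a w)
  have "inv a \<noteq> inv (inv (hd w))" if "w \<noteq> []"
    using Cons.prems that by (cases w) (auto simp: reduced_Cons)
  moreover have "last (winv w) = inv (hd w)" if "w \<noteq> []"
    using that by (simp add: winv_def last_rev hd_map)
  ultimately show ?case using Cons by (auto simp: winv_Cons reduced_append_iff reduced_Cons)
qed simp

section \<open>From letters of the group to formal letters\<close>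

definition letter_code :: "'a \<Rightarrow> 'a \<times> bool" where
  "letter_code a = (if a \<in> X then (a, True) else (inv a, False))"

lemma formal_val_eqD:
  assumes "u \<in> lists (X \<times> UNIV)" "v \<in> lists (X \<times> UNIV)" "formal_reduced u"
    "formal_reduced v" "formal_val G (\<lambda>x. x) u = formal_val G (\<lambda>x. x) v"
  shows "u = v"
  using basis assms formal_reduced_unique[of X u v] by (auto simp: free_group_basis_def)

text \<open>Otherwise \<open>(inv a, True)\<close> and \<open>(a, False)\<close> would give distinct
  reduced one-letter formal words with the same value.\<close>

lemma inv_not_in_basis: "a \<in> X \<Longrightarrow> inv a \<notin> X"
proof
  assume a: "a \<in> X" "inv a \<in> X"
  then have "[(inv a, True)] = [(a, False)]"
    using X_carrier by (intro formal_val_eqD) (auto simp: formal_reduced_def)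
  then show False by simp
qed

lemma letter_code_in: "a \<in> A \<Longrightarrow> letter_code a \<in> X \<times> UNIV"
  using X_carrier by (auto simp: letter_code_def sym_gens_def)

lemma letter_code_inv:
  "a \<in> A \<Longrightarrow> letter_code (inv a) = (fst (letter_code a), \<not> snd (letter_code a))"
  using X_carrier inv_not_in_basis by (auto simp: letter_code_def sym_gens_def)

lemma letter_code_eqD: "\<lbrakk>letter_code a = letter_code b; a \<in> A; b \<in> A\<rbrakk> \<Longrightarrow> a = b"
  using X_carrier inv_not_in_basis by (auto simp: letter_code_def sym_gens_def split: if_splits)

lemma formal_val_letter_code:
  "w \<in> lists A \<Longrightarrow> formal_val G (\<lambda>x. x) (map letter_code w) = val w"
  by (induction w) (auto simp: letter_code_def)

lemma formal_reduced_letter_code: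
  "\<lbrakk>w \<in> lists A; reduced w\<rbrakk> \<Longrightarrow> formal_reduced (map letter_code w)"
proof (induction w)
  case (Cons a w)
  have "letter_code (hd w) \<noteq> letter_code (inv a)" if "w \<noteq> []"
    using Cons.prems that letter_code_eqD[of "hd w" "inv a"] by (cases w) (auto simp: reduced_Cons)
  then show ?case using Cons
    by (auto simp: formal_reduced_def successively_Cons reduced_Cons letter_code_inv hd_map)
qed (simp add: formal_reduced_def)

text \<open>On words over \<open>A\<close> the coding by \<open>letter_code\<close> is injective and
  preserves values and reducedness, so uniqueness carries over from formal words.\<close>

lemma reduced_unique:
  assumes "u \<in> lists A" "v \<in> lists A" "reduced u" "reduced v" "val u = val v"
  shows "u = v"
proof -
  have "map letter_code u = map letter_code v"
    using assms letter_code_in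
    by (intro formal_val_eqD)
      (auto simp: formal_reduced_letter_code formal_val_letter_code in_lists_conv_set)
  then show ?thesis
    by (rule map_inj_on) (use assms letter_code_eqD in \<open>auto intro!: inj_onI simp: in_lists_conv_set\<close>)
qed

lemma reduced_cancel: "\<lbrakk>reduced w; a \<in> A; w \<in> lists A\<rbrakk> \<Longrightarrow>
  \<exists>r \<in> lists A. reduced r \<and> val r = a \<otimes> val w \<and>
    ((\<exists>w'. w = inv a # w' \<and> r = w') \<or> r = a # w)"
proof (cases "w \<noteq> [] \<and> hd w = inv a")
  case True
  moreover assume "reduced w" "a \<in> A" "w \<in> lists A"
  ultimately show ?thesis
    by (cases w) (auto simp: reduced_Cons m_assoc[symmetric])
next
  case False
  moreover assume "reduced w" "a \<in> A" "w \<in> lists A"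
  ultimately show ?thesis
    by (intro bexI[of _ "a # w"]) (auto simp: reduced_Cons)
qed

lemma reduced_rep: "w \<in> lists A \<Longrightarrow> \<exists>r \<in> lists A. reduced r \<and> val r = val w"
proof (induction w)
  case (Cons a w)
  then obtain r where "r \<in> lists A" "reduced r" "val r = val w" by auto
  then show ?case using reduced_cancel[of r a] Cons.prems by auto
qed (auto intro!: bexI[of _ "[]"])

lemma carrier_val: "g \<in> carrier G \<Longrightarrow> \<exists>w \<in> lists A. val w = g"
proof -
  assume "g \<in> carrier G"
  then have "g \<in> generate G X" using basis by (simp add: free_group_basis_def)
  then obtain w where "w \<in> lists (X \<times> UNIV)" "formal_val G (\<lambda>x. x) w = g"
    using formal_val_surj[OF X_carrier] by blast
  then show ?thesis
    by (intro bexI[of _ "map (\<lambda>(x, b). if b then x else inv x) w"])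
      (fastforce simp: formal_val_def sym_gens_def in_lists_conv_set)+
qed

lemma carrier_reduced: "g \<in> carrier G \<Longrightarrow> \<exists>r \<in> lists A. reduced r \<and> val r = g"
  using carrier_val reduced_rep by metis

text \<open>In the Cayley tree every path between two points passes through each point of the
  geodesic.\<close>

lemma split_at_reduced:
  assumes "u \<in> lists A" "w1 \<in> lists A" "w2 \<in> lists A" "reduced (w1 @ w2)"
    "val u = val (w1 @ w2)"
  shows "\<exists>u1 u2. u = u1 @ u2 \<and> val u1 = val w1 \<and> val u2 = val w2"
  using assms
proof (induction u arbitrary: w1 rule: list.induct)
  case Nil
  then have "w1 @ w2 = []" using reduced_unique[of "w1 @ w2" "[]"] by auto
  then show ?case by auto
next
  case (Cons a u)
  show ?case
  proof (cases "w1 = []")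
    case True
    then have "a # u = [] @ (a # u) \<and> val [] = val w1 \<and> val (a # u) = val w2"
      using Cons.prems by simp
    then show ?thesis by blast
  next
    case False
    have a: "a \<in> A" and u: "u \<in> lists A" using Cons.prems by auto
    have "val u = inv a \<otimes> val (a # u)"
      using a u by (simp add: m_assoc[symmetric])
    then have u_val: "val u = inv a \<otimes> val (w1 @ w2)" using Cons.prems by simp
    show ?thesis
    proof (cases "hd w1 = a")
      case True
      then obtain w where w: "w1 = a # w" using False by (cases w1) auto
      have wl: "w \<in> lists A" using Cons.prems w by auto
      have "val u = val (w @ w2)"
        using u_val w a wl Cons.prems(3) by (simp add: m_assoc[symmetric])
      moreover have "reduced (w @ w2)" using Cons.prems w by (simp add: reduced_Cons)
      ultimately obtain u1 u2 where "u = u1 @ u2" "val u1 = val w" "val u2 = val w2"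
        using Cons.IH[of w] u wl Cons.prems(3) by blast
      then show ?thesis using w by (intro exI[of _ "a # u1"] exI[of _ u2]) auto
    next
      case ne: False
      \<comment> \<open>A first letter other than \<open>hd w1\<close> leads away from the geodesic.
        Seen from the new point the geodesic is longer by \<open>inv a\<close>, still reduced, and
        has the same tail \<open>w2\<close>.\<close>
      let ?w = "inv a # w1"
      have wl: "?w \<in> lists A" using a Cons.prems by auto
      have "reduced (?w @ w2)" using Cons.prems ne False a by (auto simp: reduced_Cons)
      moreover have "val u = val (?w @ w2)" using u_val by simp
      ultimately obtain u1 u2 where uu: "u = u1 @ u2" "val u1 = val ?w" "val u2 = val w2"
        using Cons.IH[of ?w] u wl Cons.prems(3) by blast
      then have "val (a # u1) = val w1"
        using a Cons.prems(2) by (simp add: m_assoc[symmetric])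
      then show ?thesis using uu by (intro exI[of _ "a # u1"] exI[of _ u2]) auto
    qed
  qed
qed

text \<open>A path with the value of \<open>a # r\<close> passes through the point \<open>a\<close>,
  and the part before that point is nonempty; induction handles the rest.\<close>

lemma reduced_shortest:
  assumes "reduced r" "r \<in> lists A" "u \<in> lists A" "val u = val r"
  shows "length r \<le> length u"
  using assms
proof (induction r arbitrary: u)
  case (Cons a r)
  then obtain u1 u2 where u: "u = u1 @ u2" "val u1 = val [a]" "val u2 = val r"
    using split_at_reduced[of u "[a]" r] by auto
  have "u1 \<noteq> []"
    using u(2) Cons.prems reduced_unique[of "[]" "[a]"] by auto
  then have "length u1 \<ge> 1" by (cases u1) auto
  moreover have "length r \<le> length u2" using Cons u by (auto simp: reduced_Cons)
  ultimately show ?case using u by simp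
qed simp

lemma not_reduced_shorten:
  assumes "w \<in> lists A" "\<not> reduced w"
  shows "\<exists>u \<in> lists A. val u = val w \<and> length u < length w"
  using assms
proof (induction w rule: list.induct)
  case (Cons a w)
  show ?case
  proof (cases "reduced w")
    case True
    then obtain w' where w: "w = inv a # w'" using Cons.prems by (cases w) (auto simp: reduced_Cons)
    then show ?thesis
      using Cons.prems by (intro bexI[of _ w']) (simp_all add: m_assoc[symmetric])
  next
    case False
    then obtain u where "u \<in> lists A" "val u = val w" "length u < length w" using Cons by auto
    then show ?thesis using Cons.prems by (intro bexI[of _ "a # u"]) auto
  qed
qed simp


section \<open>Conjugation of cyclically reduced words\<close>

text \<open>Let \<open>p\<close> be the longest common suffix of \<open>r\<close> and
  \<open>w\<close>. If it is all of \<open>w\<close>, one factor \<open>w\<close> is stripped from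
  \<open>r\<close> and induction continues. Otherwise \<open>s\<close>, unless empty, and
  \<open>q\<close> end in different letters, so nothing cancels between \<open>q\<close> and
  \<open>winv s\<close>, while \<open>s @ p @ q\<close> is a prefix of the reduced word
  \<open>r @ w\<close>.\<close>

lemma reduced_conj_decomp_one_sided:
  assumes "w \<noteq> []" "w \<in> lists A" "reduced (w @ w)" "r \<in> lists A" "reduced (r @ w)"
  shows "\<exists>q p s n. w = q @ p \<and> r = s @ p @ wpow n w \<and> reduced (s @ p @ q @ winv s)"
  using assms(4,5)
proof (induction "length r" arbitrary: r rule: less_induct)
  case less
  obtain p s q where psq: "r = s @ p" "w = q @ p" "s = [] \<or> q = [] \<or> last s \<noteq> last q"
    using longest_common_suffix[of r w] by blast
  show ?case
  proof (cases "q = []")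
    case True
    then have r: "r = s @ w" using psq by simp
    then obtain q' p' s' n where
      "w = q' @ p'" "s = s' @ p' @ wpow n w" "reduced (s' @ p' @ q' @ winv s')"
      using less.hyps[of s] less.prems assms(1) by (auto simp: reduced_append_iff)
    then show ?thesis using r by (intro exI[of _ q'] exI[of _ p'] exI[of _ s'] exI[of _ "Suc n"])
        (auto simp: wpow_Suc)
  next
    case False
    have "reduced ((s @ p @ q) @ winv s)"
      unfolding reduced_append_iff[of "s @ p @ q"]
    proof (intro conjI)
      show "reduced (s @ p @ q)"
        using less.prems(2) reduced_append_iff[of "s @ p @ q" p] psq by simp
      show "reduced (winv s)"
        using less.prems psq by (auto intro: reduced_winv simp: reduced_append_iff)
      show "s @ p @ q = [] \<or> winv s = [] \<or> hd (winv s) \<noteq> inv last (s @ p @ q)"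
      proof (cases "s = []")
        case sne: False
        then have "last s \<noteq> last q" "last s \<in> A" "last q \<in> A"
          using psq False less.prems(1) assms(2) by (auto simp: in_lists_conv_set)
        then have "inv last s \<noteq> inv last q" using inv_inv letter_carrier by metis
        then show ?thesis using sne False by (simp add: hd_winv)
      qed simp
    qed
    then show ?thesis using psq
      by (intro exI[of _ q] exI[of _ p] exI[of _ s] exI[of _ 0]) simp
  qed
qed

text \<open>A reduced word cannot cancel against both a cyclically reduced word and its inverse.\<close>

lemma reduced_conj_decomp:
  assumes w: "w \<noteq> []" "w \<in> lists A" "reduced (w @ w)" and r: "r \<in> lists A" "reduced r"
  obtains q p s n where "w = q @ p" "s \<in> lists A" "reduced (s @ p @ q @ winv s)"
    "r = s @ p @ wpow n w \<or> r = s @ winv q @ wpow n (winv w)"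
proof (cases "reduced (r @ w)")
  case True
  then show ?thesis
    using reduced_conj_decomp_one_sided[OF w r(1)] that r(1) by auto
next
  case False
  have "hd w = inv last r" "r \<noteq> []"
    using False w r by (auto simp: reduced_append_iff)
  moreover have "hd w \<noteq> inv last w" using w by (auto simp: reduced_append_iff)
  ultimately have "last r \<noteq> last w" by metis
  moreover have "last r \<in> A" "last w \<in> A"
    using w r \<open>r \<noteq> []\<close> by (auto simp: in_lists_conv_set)
  ultimately have "inv last r \<noteq> inv last w" using inv_inv letter_carrier by metis
  then have "reduced (r @ winv w)"
    using w r reduced_winv[of w] by (auto simp: reduced_append_iff hd_winv)
  moreover have "reduced (winv w @ winv w)"
    using reduced_winv[of "w @ w"] w by simp
  ultimately obtain q p s n where
    qp: "winv w = q @ p" "r = s @ p @ wpow n (winv w)" "reduced (s @ p @ q @ winv s)"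
    using reduced_conj_decomp_one_sided[of "winv w" r] w r by auto
  have lists: "q \<in> lists A" "p \<in> lists A" "s \<in> lists A"
    using r qp winv_lists[OF w(2)] by auto
  show ?thesis
  \<comment> \<open>Inverting the factorization \<open>q @ p\<close> of \<open>winv w\<close> gives
    the factorization \<open>winv p @ winv q\<close> of \<open>w\<close>, so the two factors change
    places.\<close>
  proof (rule that[of "winv p" "winv q" s n])
    show "w = winv p @ winv q" using qp(1) winv_winv[OF w(2)] by simp
    have "winv (s @ p @ q @ winv s) = s @ winv q @ winv p @ winv s"
      using lists by simp
    then show "reduced (s @ winv q @ winv p @ winv s)"
      using reduced_winv[OF _ qp(3)] lists by simp
  qed (use lists qp in auto)
qed

text \<open>In the group p (q p) = (p q) p and q^-1 (q p) = (p q) q^-1, and powers of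
  \<open>w\<close> commute with \<open>w\<close>. The words may cancel here, which allows the
  application to the replaced words in \<open>alpha_invariant\<close>.\<close>

lemma val_conj_decomp:
  assumes "w = q @ p" "q \<in> lists A" "p \<in> lists A" "s \<in> lists A"
    "r = s @ p @ wpow n w \<or> r = s @ winv q @ wpow n (winv w)"
  shows "val w = inv (val r) \<otimes> val (s @ p @ q @ winv s) \<otimes> val r"
proof -
  define a b c where abc: "a = val q" "b = val p" "c = val s"
  have [simp]: "a \<in> carrier G" "b \<in> carrier G" "c \<in> carrier G" using assms abc by auto
  have cancel: "x \<otimes> (inv x \<otimes> y) = y" "inv x \<otimes> (x \<otimes> y) = y"
    if "x \<in> carrier G" "y \<in> carrier G" for x y
    using that by (simp_all add: m_assoc[symmetric])
  have comm: "(a \<otimes> b) \<otimes> g [^] n = g [^] n \<otimes> (a \<otimes> b)"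
    if "g = a \<otimes> b \<or> g = inv (a \<otimes> b)" for g
    using that by (intro group_commutes_pow[symmetric]) auto
  \<comment> \<open>Here \<open>d\<close> stands for \<open>b\<close> or \<open>inv a\<close>, which
    intertwines \<open>a \<otimes> b\<close> with \<open>b \<otimes> a\<close>, and \<open>g\<close>
    for the power of \<open>a \<otimes> b\<close> or of its inverse.\<close>
  have main: "a \<otimes> b = inv v \<otimes> (c \<otimes> b \<otimes> a \<otimes> inv c) \<otimes> v"
    if v: "v = c \<otimes> d \<otimes> g" and cl: "d \<in> carrier G" "g \<in> carrier G"
      and d: "b \<otimes> a \<otimes> d = d \<otimes> (a \<otimes> b)" and g: "(a \<otimes> b) \<otimes> g = g \<otimes> (a \<otimes> b)" for v d g
  proof -
    have "(c \<otimes> b \<otimes> a \<otimes> inv c) \<otimes> v = c \<otimes> ((b \<otimes> a \<otimes> d) \<otimes> g)"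
      using cl by (simp add: v m_assoc cancel)
    also have "\<dots> = c \<otimes> d \<otimes> ((a \<otimes> b) \<otimes> g)"
      unfolding d using cl by (simp add: m_assoc)
    also have "\<dots> = v \<otimes> (a \<otimes> b)"
      unfolding g using cl by (simp add: v m_assoc)
    finally have "(c \<otimes> b \<otimes> a \<otimes> inv c) \<otimes> v = v \<otimes> (a \<otimes> b)" .
    moreover have "v \<in> carrier G" using cl v by simp
    ultimately show ?thesis by (simp add: m_assoc cancel)
  qed
  have vw: "val w = a \<otimes> b" "val (s @ p @ q @ winv s) = c \<otimes> b \<otimes> a \<otimes> inv c"
    using assms by (simp_all add: abc m_assoc)
  have wl: "w \<in> lists A" using assms by simp
  from assms(5) show ?thesis
  proof
    assume "r = s @ p @ wpow n w"
    then have "val r = c \<otimes> b \<otimes> (a \<otimes> b) [^] n" using assms(2-4) wl vw by (simp add: abc m_assoc)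
    then show ?thesis unfolding vw by (rule main[OF _ _ _ _ comm]) (simp_all add: m_assoc)
  next
    assume "r = s @ winv q @ wpow n (winv w)"
    then have "val r = c \<otimes> inv a \<otimes> (inv (a \<otimes> b)) [^] n"
      using assms(2-4) wl vw by (simp add: abc m_assoc)
    then show ?thesis unfolding vw
      by (rule main[OF _ _ _ _ comm]) (simp_all add: m_assoc cancel)
  qed
qed

section \<open>Word length, conjugacy length and shortlex representatives\<close>

lemma word_length_le: "w \<in> lists A \<Longrightarrow> word_length G X (val w) \<le> length w"
  unfolding word_length_def by (rule Least_le) auto

lemma word_length_attained:
  "g \<in> carrier G \<Longrightarrow> \<exists>w \<in> lists A. val w = g \<and> length w = word_length G X g"
  unfolding word_length_def by (rule LeastI_ex) (use carrier_val in blast)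

lemma word_length_reduced:
  "\<lbrakk>reduced r; r \<in> lists A\<rbrakk> \<Longrightarrow> word_length G X (val r) = length r"
  using word_length_le[of r] word_length_attained[of "val r"] reduced_shortest[of r] by force

lemma conj_length_le: "conjugate G h g \<Longrightarrow> conj_length G X g \<le> word_length G X h"
  unfolding conj_length_def by (rule Least_le) auto

lemma conjugate_refl: "g \<in> carrier G \<Longrightarrow> conjugate G g g"
  unfolding conjugate_def by (rule bexI[of _ \<one>]) auto

lemma conj_length_attained:
  "g \<in> carrier G \<Longrightarrow> \<exists>h. conjugate G h g \<and> word_length G X h = conj_length G X g"
  unfolding conj_length_def by (rule LeastI_ex) (use conjugate_refl in blast)

text \<open>A word that is not cyclically reduced gets shorter by a cancellation or by conjugating
  away its first and last letters. Conversely, every conjugate of a nonempty cyclically reduced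
  \<open>w\<close> has a reduced word of the form \<open>s @ p @ q @ winv s\<close> with
  \<open>w = q @ p\<close>, which is at least as long as \<open>w\<close>.\<close>

lemma length_eq_conj_length_iff:
  assumes w: "w \<in> lists A"
  shows "length w = conj_length G X (val w) \<longleftrightarrow> reduced (w @ w)"
proof
  assume len: "length w = conj_length G X (val w)"
  have min: "length w \<le> length u" if "u \<in> lists A" "conjugate G (val u) (val w)" for u
    using len conj_length_le[OF that(2)] word_length_le[OF that(1)] by simp
  have red: "reduced w"
    using not_reduced_shorten[OF w] min conjugate_refl[OF val_closed[OF w]] by fastforce
  have "hd w \<noteq> inv last w" if ne: "w \<noteq> []"
  proof
    assume hd: "hd w = inv last w"
    define a where "a = last w"
    have a: "a \<in> A" using w ne by (simp add: a_def in_lists_conv_set)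
    \<comment> \<open>This excludes the one-letter word, whose first and last letters coincide; a
      letter and its inverse have opposite signs under \<open>letter_code\<close>.\<close>
    have "inv a \<noteq> a"
    proof
      assume "inv a = a"
      then show False using letter_code_inv[OF a] by (metis prod.sel(2))
    qed
    then obtain m where m: "w = inv a # m @ [a]"
      using ne hd unfolding a_def by (cases w; cases "tl w" rule: rev_cases) auto
    have ml: "m \<in> lists A" using m w by simp
    have "val m = inv (inv a) \<otimes> val w \<otimes> inv a"
      using m ml a by (simp add: m_assoc[symmetric]) (simp add: m_assoc)
    then have "conjugate G (val m) (val w)"
      unfolding conjugate_def using a by (intro bexI[of _ "inv a"]) auto
    then show False using min[OF ml] m by simp
  qed
  then show "reduced (w @ w)" using red by (auto simp: reduced_append_iff)
next
  assume red: "reduced (w @ w)"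
  then have redw: "reduced w" by (simp add: reduced_append_iff)
  have vw: "val w \<in> carrier G" using w by simp
  obtain h where h: "conjugate G h (val w)" "word_length G X h = conj_length G X (val w)"
    using conj_length_attained vw by blast
  have "length w \<le> word_length G X h"
  proof (cases "w = []")
    case False
    obtain x where x: "x \<in> carrier G" "h = inv x \<otimes> val w \<otimes> x"
      using h(1) by (auto simp: conjugate_def)
    \<comment> \<open>The decomposition concerns r w r^-1 while \<open>h\<close> is x^-1 w x, hence
      a word for \<open>inv x\<close>.\<close>
    obtain r where r: "r \<in> lists A" "reduced r" "val r = inv x"
      using carrier_reduced x by blast
    obtain q p s n where d: "w = q @ p" "s \<in> lists A" "reduced (s @ p @ q @ winv s)"
      "r = s @ p @ wpow n w \<or> r = s @ winv q @ wpow n (winv w)"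
      using reduced_conj_decomp[OF False w red r(1,2)] .
    have l: "q \<in> lists A" "p \<in> lists A" using d(1) w by auto
    define u where "u = s @ p @ q @ winv s"
    have u: "u \<in> lists A" "reduced u" using d l by (auto simp: u_def)
    have "val w = x \<otimes> val u \<otimes> inv x"
      using val_conj_decomp[OF d(1) l d(2,4)] r x by (simp add: u_def)
    then have "h = (inv x \<otimes> x) \<otimes> val u \<otimes> (inv x \<otimes> x)"
      using x u(1) by (simp only: m_assoc val_closed inv_closed m_closed)
    then have "h = val u" using x u by simp
    then have "word_length G X h = length u" using word_length_reduced u by simp
    then show ?thesis using d(1) by (simp add: u_def)
  qed simp
  then show "length w = conj_length G X (val w)"
    using h conj_length_le[OF conjugate_refl[OF vw]] word_length_reduced[OF redw w] by simp
qed

text \<open>The reduced word is strictly shorter than every other word with its value, so the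
  comparison of lengths in \<open>lenlex\<close> settles both existence and uniqueness.\<close>

lemma shortlex_rep_val:
  assumes r: "r \<in> lists A" "reduced r"
  shows "shortlex_rep G X R (val r) = r"
proof -
  have longer: "length r < length w" if w: "w \<in> lists A" "val w = val r" "w \<noteq> r" for w
  proof -
    have "\<not> reduced w" using reduced_unique[OF w(1) r(1) _ r(2) w(2)] w(3) by blast
    then obtain u where "u \<in> lists A" "val u = val w" "length u < length w"
      using not_reduced_shorten[OF w(1)] by blast
    then show ?thesis using reduced_shortest[OF r(2,1), of u] w(2) by simp
  qed
  show ?thesis
    unfolding shortlex_rep_def
  proof (rule the_equality)
    show "r \<in> lists A \<and> val r = val r \<and>
        (\<forall>w' \<in> lists A. val w' = val r \<longrightarrow> w' \<noteq> r \<longrightarrow> (r, w') \<in> lenlex (R - Id))"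
      using r longer by (auto simp: lenlex_conv)
  next
    fix w
    assume w: "w \<in> lists A \<and> val w = val r \<and>
        (\<forall>w' \<in> lists A. val w' = val r \<longrightarrow> w' \<noteq> w \<longrightarrow> (w, w') \<in> lenlex (R - Id))"
    show "w = r"
    proof (rule ccontr)
      assume "w \<noteq> r"
      then have "(w, r) \<in> lenlex (R - Id)" "length r < length w" using w r longer by auto
      then show False by (auto simp: lenlex_conv)
    qed
  qed
qed

lemma ConjGeo_eq:
  "ConjGeo G X U V = {w \<in> lists A. reduced (w @ w) \<and> val w \<in> alpha G U V}"
  unfolding ConjGeo_def using length_eq_conj_length_iff by auto

text \<open>Each element of the group has a single geodesic word, its reduced word, so choosing the
  shortlex-least one loses nothing. The inclusions put \<open>alpha G U V\<close> inside the
  carrier.\<close>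

lemma ConjMinLenSL_eq_ConjGeo:
  assumes "U \<subseteq> carrier G" "V \<subseteq> carrier G"
  shows "ConjMinLenSL G X R U V = ConjGeo G X U V"
proof (intro Set.set_eqI iffI)
  fix w assume "w \<in> ConjMinLenSL G X R U V"
  then obtain g where g: "w = shortlex_rep G X R g" "g \<in> alpha G U V"
    "word_length G X g = conj_length G X g" by (auto simp: ConjMinLenSL_def)
  then have "g \<in> carrier G" using assms by (auto simp: alpha_def subset_iff)
  then obtain r where r: "r \<in> lists A" "reduced r" "val r = g" using carrier_reduced by blast
  then have "w = r" using g shortlex_rep_val by blast
  moreover have "length r = conj_length G X (val r)"
    using g(3) word_length_reduced r by auto
  ultimately show "w \<in> ConjGeo G X U V" using g r by (simp add: ConjGeo_def)
next
  fix w assume w: "w \<in> ConjGeo G X U V"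
  then have "w \<in> lists A" "reduced w" by (auto simp: ConjGeo_eq reduced_append_iff)
  then have "w = shortlex_rep G X R (val w)" "word_length G X (val w) = conj_length G X (val w)"
    using w by (simp_all add: shortlex_rep_val word_length_reduced ConjGeo_def)
  then show "w \<in> ConjMinLenSL G X R U V" using w unfolding ConjMinLenSL_def ConjGeo_def by auto
qed

section \<open>Action of words on the states of an automaton\<close>

text \<open>Only the value of \<open>w\<close> enters. Words with equal value may lead from one
  state to different states, so group elements act by relations although the automaton is
  deterministic.\<close>

definition run_rel :: "nat set \<Rightarrow> (nat \<Rightarrow> 'a \<Rightarrow> nat) \<Rightarrow> 'a list \<Rightarrow> nat rel" where
  "run_rel Q \<delta> w = {(i, foldl \<delta> i u) | i u. i \<in> Q \<and> u \<in> lists A \<and> val u = val w}"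

lemma run_rel_iff:
  "(i, j) \<in> run_rel Q \<delta> w \<longleftrightarrow>
    i \<in> Q \<and> (\<exists>u \<in> lists A. val u = val w \<and> foldl \<delta> i u = j)"
  by (auto simp: run_rel_def)

text \<open>Runs concatenate even if letters cancel between \<open>w\<close> and \<open>w'\<close>;
  this inclusion serves words that are not known to be reduced.\<close>

lemma run_rel_append_superset:
  assumes "w \<in> lists A" "w' \<in> lists A"
  shows "run_rel Q \<delta> w O run_rel Q \<delta> w' \<subseteq> run_rel Q \<delta> (w @ w')"
proof clarify
  fix i j k
  assume "(i, j) \<in> run_rel Q \<delta> w" "(j, k) \<in> run_rel Q \<delta> w'"
  then obtain u u' where "i \<in> Q" "u \<in> lists A" "u' \<in> lists A" "val u = val w" "val u' = val w'"
    "foldl \<delta> i u = j" "foldl \<delta> j u' = k" by (auto simp: run_rel_iff)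
  then show "(i, k) \<in> run_rel Q \<delta> (w @ w')"
    unfolding run_rel_iff using assms by (intro conjI bexI[of _ "u @ u'"]) auto
qed

lemma run_rel_wpow_superset:
  assumes "r \<in> lists A" "w \<in> lists A"
  shows "run_rel Q \<delta> r O (run_rel Q \<delta> w ^^ n) \<subseteq> run_rel Q \<delta> (r @ wpow n w)"
proof (induction n)
  case (Suc n)
  then show ?case
    using run_rel_append_superset[of "r @ wpow n w" w Q \<delta>] assms
    by (simp add: wpow_Suc O_assoc[symmetric]) (meson relcomp_mono order_trans order_refl)
qed simp

end

locale complete_automaton = free_group_with_basis +
  fixes Q :: "nat set" and \<delta> :: "nat \<Rightarrow> 'a \<Rightarrow> nat"
  assumes finite_states: "finite Q"
    and step_closed: "\<And>q a. \<lbrakk>q \<in> Q; a \<in> A\<rbrakk> \<Longrightarrow> \<delta> q a \<in> Q"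
begin

lemma foldl_closed: "\<lbrakk>u \<in> lists A; i \<in> Q\<rbrakk> \<Longrightarrow> foldl \<delta> i u \<in> Q"
  by (induction u arbitrary: i rule: list.induct) (auto simp: step_closed)

lemma run_rel_subset: "run_rel Q \<delta> w \<subseteq> Q \<times> Q"
  using foldl_closed by (auto simp: run_rel_def)

text \<open>The content of Benois' theorem: on reduced words the automaton, saturated by all trivial
  detours, still composes letter by letter.\<close>

lemma run_rel_append:
  assumes "w \<in> lists A" "w' \<in> lists A" "reduced (w @ w')"
  shows "run_rel Q \<delta> (w @ w') = run_rel Q \<delta> w O run_rel Q \<delta> w'"
proof
  show "run_rel Q \<delta> (w @ w') \<subseteq> run_rel Q \<delta> w O run_rel Q \<delta> w'"
  proof clarify
    fix i k assume "(i, k) \<in> run_rel Q \<delta> (w @ w')"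
    then obtain u where u: "i \<in> Q" "u \<in> lists A" "val u = val (w @ w')" "foldl \<delta> i u = k"
      by (auto simp: run_rel_iff)
    then obtain u1 u2 where s: "u = u1 @ u2" "val u1 = val w" "val u2 = val w'"
      using split_at_reduced[OF u(2) assms u(3)] by blast
    have "foldl \<delta> i u1 \<in> Q" using u s by (simp add: foldl_closed)
    then have "(i, foldl \<delta> i u1) \<in> run_rel Q \<delta> w" "(foldl \<delta> i u1, k) \<in> run_rel Q \<delta> w'"
      unfolding run_rel_iff using u s
      by (simp_all add: bexI[of _ u1] bexI[of _ u2])
    then show "(i, k) \<in> run_rel Q \<delta> w O run_rel Q \<delta> w'" by blast
  qed
qed (rule run_rel_append_superset[OF assms(1,2)])

lemma run_rel_wpow:
  assumes "r \<in> lists A" "w \<in> lists A" "reduced (r @ wpow n w)"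
  shows "run_rel Q \<delta> (r @ wpow n w) = run_rel Q \<delta> r O (run_rel Q \<delta> w ^^ n)"
  using assms(3)
proof (induction n)
  case (Suc n)
  then have red: "reduced ((r @ wpow n w) @ w)" by (simp add: wpow_Suc)
  then have "reduced (r @ wpow n w)" using reduced_append_iff by blast
  then show ?case
    using run_rel_append[OF _ _ red] Suc.IH assms by (simp add: wpow_Suc O_assoc)
qed simp

end


section \<open>Conjugation and rational sets\<close>

context free_group_with_basis
begin

lemma rational_subset_automaton:
  assumes "rational_subset G X S"
  obtains Q \<delta> i F where "complete_automaton G X Q \<delta>" "i \<in> Q"
    "S = val ` {w \<in> lists A. foldl \<delta> i w \<in> F}"
proof -
  obtain L where L: "regular_language A L" "val ` L = S"
    using assms unfolding rational_subset_def by blast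
  from L(1) show thesis
    unfolding regular_language_def
  proof (elim conjE exE)
    fix Q :: "nat set" and i F \<delta>
    assume aut: "finite Q" "i \<in> Q" "\<forall>q \<in> Q. \<forall>a \<in> A. \<delta> q a \<in> Q"
      "L = {w \<in> lists A. foldl \<delta> i w \<in> F}"
    have "complete_automaton G X Q \<delta>" by unfold_locales (use aut in auto)
    then show thesis using that[of Q \<delta> i F] aut(2,4) L(2) by simp
  qed
qed

lemma val_in_rational_iff:
  assumes "q0 \<in> Q" "r \<in> lists A"
  shows "val r \<in> val ` {w \<in> lists A. foldl \<delta> q0 w \<in> F} \<longleftrightarrow>
    (\<exists>f \<in> F. (q0, f) \<in> run_rel Q \<delta> r)"
proof
  assume "val r \<in> val ` {w \<in> lists A. foldl \<delta> q0 w \<in> F}"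
  then obtain w where "val r = val w" "w \<in> {w \<in> lists A. foldl \<delta> q0 w \<in> F}"
    by (rule imageE)
  then show "\<exists>f \<in> F. (q0, f) \<in> run_rel Q \<delta> r"
    unfolding run_rel_iff using assms(1)
    by (intro bexI[of _ "foldl \<delta> q0 w"] conjI bexI[of _ w]) simp_all
next
  assume "\<exists>f \<in> F. (q0, f) \<in> run_rel Q \<delta> r"
  then obtain w where "w \<in> lists A" "foldl \<delta> q0 w \<in> F" "val w = val r"
    by (auto simp: run_rel_iff)
  then show "val r \<in> val ` {w \<in> lists A. foldl \<delta> q0 w \<in> F}" by (auto intro!: image_eqI[of _ _ w])
qed

text \<open>One accepting pair of states suffices for membership, so an inclusion between the
  actions transfers it.\<close>

lemma val_in_rational_mono:
  assumes "q0 \<in> Q" "r \<in> lists A" "r' \<in> lists A" "run_rel Q \<delta> r \<subseteq> run_rel Q \<delta> r'"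
    and "val r \<in> val ` {w \<in> lists A. foldl \<delta> q0 w \<in> F}"
  shows "val r' \<in> val ` {w \<in> lists A. foldl \<delta> q0 w \<in> F}"
  unfolding val_in_rational_iff[OF assms(1,3)]
  using assms(4,5) unfolding val_in_rational_iff[OF assms(1,2)] by blast

end

section \<open>The finite right invariant of a word\<close>

locale automaton_pair = free_group_with_basis +
  fixes Q\<^sub>U Q\<^sub>V :: "nat set" and \<delta>\<^sub>U \<delta>\<^sub>V :: "nat \<Rightarrow> 'a \<Rightarrow> nat"
  assumes aut_U: "complete_automaton G X Q\<^sub>U \<delta>\<^sub>U" and aut_V: "complete_automaton G X Q\<^sub>V \<delta>\<^sub>V"
begin

abbreviation "run\<^sub>U \<equiv> run_rel Q\<^sub>U \<delta>\<^sub>U"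
abbreviation "run\<^sub>V \<equiv> run_rel Q\<^sub>V \<delta>\<^sub>V"

text \<open>The words to be followed are s p q s^-1 in the automaton of \<open>U\<close> and s p w^n
  or s q^-1 w^-n in that of \<open>V\<close>, so the action of the inverse is recorded for
  \<open>V\<close> only.\<close>

definition profile :: "'a list \<Rightarrow> nat rel \<times> nat rel \<times> nat rel" where
  "profile w = (run\<^sub>U w, run\<^sub>V w, run\<^sub>V (winv w))"

definition profile_step :: "nat rel \<times> nat rel \<times> nat rel \<Rightarrow> 'a \<Rightarrow> nat rel \<times> nat rel \<times> nat rel" where
  "profile_step m a =
    (fst m O run\<^sub>U [a], fst (snd m) O run\<^sub>V [a], run\<^sub>V [inv a] O snd (snd m))"

definition split_profiles where
  "split_profiles w = {(profile q, profile p) | q p. w = q @ p}"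

text \<open>Words that are not reduced share the value \<open>None\<close>, as no extension of them
  is reduced. The first and last letters decide whether \<open>w @ [a]\<close> and
  \<open>w @ w\<close> are reduced; emptiness is recorded separately, since \<open>hd []\<close> and
  \<open>last []\<close> might coincide with letters.\<close>

definition invariant where
  "invariant w =
    (if reduced w then Some (w = [], hd w, last w, profile w, split_profiles w) else None)"

lemma invariant_eqD:
  assumes "invariant w = invariant w'" "reduced w"
  shows "reduced w'" "w = [] \<longleftrightarrow> w' = []" "hd w = hd w'" "last w = last w'"
    "profile w = profile w'" "split_profiles w = split_profiles w'"
proof -
  from assms show red: "reduced w'" by (simp add: invariant_def split: if_splits)
  have "(w = [], hd w, last w, profile w, split_profiles w) =
      (w' = [], hd w', last w', profile w', split_profiles w')"
    using assms red unfolding invariant_def by (metis option.inject)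
  then show "w = [] \<longleftrightarrow> w' = []" "hd w = hd w'" "last w = last w'"
    "profile w = profile w'" "split_profiles w = split_profiles w'"
    by (blast dest: Pair_inject)+
qed

lemma profile_snoc:
  assumes "w \<in> lists A" "a \<in> A" "reduced (w @ [a])"
  shows "profile (w @ [a]) = profile_step (profile w) a"
proof -
  have "reduced ([inv a] @ winv w)"
    using reduced_winv[OF _ assms(3)] assms by (simp add: winv_Cons)
  then have "run\<^sub>V ([inv a] @ winv w) = run\<^sub>V [inv a] O run\<^sub>V (winv w)"
    using assms by (intro complete_automaton.run_rel_append[OF aut_V]) auto
  then show ?thesis
    using assms complete_automaton.run_rel_append[OF aut_U, of w "[a]"]
      complete_automaton.run_rel_append[OF aut_V, of w "[a]"]
    by (simp add: profile_def profile_step_def winv_Cons)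
qed

text \<open>A factorization of \<open>w @ [a]\<close> either has an empty second factor or arises
  from one of \<open>w\<close> by appending \<open>a\<close> to the second factor, which stays
  reduced as a suffix of a reduced word.\<close>

lemma split_profiles_snoc:
  assumes "w \<in> lists A" "a \<in> A" "reduced (w @ [a])"
  shows "split_profiles (w @ [a]) =
    insert (profile_step (profile w) a, profile [])
      ((\<lambda>(m, m'). (m, profile_step m' a)) ` split_profiles w)"
proof -
  have splits: "w @ [a] = q @ p \<longleftrightarrow> q = w @ [a] \<and> p = [] \<or> (\<exists>p'. p = p' @ [a] \<and> w = q @ p')" for q p
    by (cases p rule: rev_cases) auto
  have "split_profiles (w @ [a]) = insert (profile (w @ [a]), profile [])
      {(profile q, profile (p @ [a])) | q p. w = q @ p}"
    unfolding split_profiles_def splits by blast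
  also have "{(profile q, profile (p @ [a])) | q p. w = q @ p} =
      {(profile q, profile_step (profile p) a) | q p. w = q @ p}"
  proof -
    have step: "profile (p @ [a]) = profile_step (profile p) a" if "w = q @ p" for q p
      using assms that reduced_append_iff[of q "p @ [a]"] by (intro profile_snoc) auto
    show ?thesis by (intro Collect_cong ex_cong1) (metis step)
  qed
  also have "\<dots> = (\<lambda>(m, m'). (m, profile_step m' a)) ` split_profiles w"
    by (force simp: split_profiles_def)
  finally show ?thesis using profile_snoc[OF assms] by simp
qed

lemma invariant_snoc:
  assumes "w \<in> lists A" "w' \<in> lists A" "a \<in> A" "invariant w = invariant w'"
  shows "invariant (w @ [a]) = invariant (w' @ [a])"
proof (cases "reduced w")
  case True
  note eq = invariant_eqD[OF assms(4) True]
  then have red: "reduced (w @ [a]) \<longleftrightarrow> reduced (w' @ [a])"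
    using True by (auto simp: reduced_append_iff)
  show ?thesis
  proof (cases "reduced (w @ [a])")
    case True
    then have "split_profiles (w @ [a]) = split_profiles (w' @ [a])"
      "profile (w @ [a]) = profile (w' @ [a])"
      using eq red assms by (simp_all add: split_profiles_snoc profile_snoc)
    then show ?thesis using red eq by (simp add: invariant_def hd_append)
  qed (use red in \<open>simp add: invariant_def\<close>)
next
  case False
  then have "\<not> reduced w'" using assms(4) by (auto simp: invariant_def split: if_splits)
  then show ?thesis using False by (simp add: invariant_def reduced_append_iff)
qed

lemma finite_invariant: "finite A \<Longrightarrow> finite (invariant ` lists A)"
proof -
  assume A: "finite A"
  define P where "P = Pow (Q\<^sub>U \<times> Q\<^sub>U) \<times> Pow (Q\<^sub>V \<times> Q\<^sub>V) \<times> Pow (Q\<^sub>V \<times> Q\<^sub>V)"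
  have P: "profile w \<in> P" for w
    unfolding profile_def P_def
    using complete_automaton.run_rel_subset[OF aut_U] complete_automaton.run_rel_subset[OF aut_V]
    by simp
  have "finite P"
    using complete_automaton.finite_states[OF aut_U] complete_automaton.finite_states[OF aut_V]
    by (simp add: P_def)
  \<comment> \<open>The unspecified values \<open>hd []\<close> and \<open>last []\<close> are added
    to the letters to account for the empty word.\<close>
  then have fin: "finite (insert None (Some ` ((UNIV :: bool set) \<times> insert (hd []) A \<times> insert (last []) A \<times>
      P \<times> Pow (P \<times> P))))"
    using A by (intro finite.insertI finite_imageI finite_cartesian_product) auto
  have "split_profiles w \<in> Pow (P \<times> P)" for w
    using P by (auto simp: split_profiles_def)
  moreover have "hd w \<in> insert (hd []) A \<and> last w \<in> insert (last []) A" if "w \<in> lists A" for w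
    using that by (cases "w = []") (auto simp: in_lists_conv_set)
  ultimately have "invariant w \<in> insert None (Some ` ((UNIV :: bool set) \<times> insert (hd []) A \<times>
      insert (last []) A \<times> P \<times> Pow (P \<times> P)))" if "w \<in> lists A" for w
    unfolding invariant_def using P that by simp
  then show ?thesis by (intro finite_subset[OF _ fin] image_subsetI)
qed

text \<open>A conjugating element \<open>v\<close> is described by \<open>s\<close>,
  \<open>n\<close> and a factorization \<open>q @ p\<close> of \<open>w\<close>. Equal invariants
  provide a factorization \<open>q' @ p'\<close> of \<open>w'\<close> with the same profiles.
  Substituting it, with the unbounded data \<open>s\<close> and \<open>n\<close> kept, yields an
  element of \<open>U\<close> and a conjugator in \<open>V\<close> that witness membership for
  \<open>w'\<close>.\<close>

lemma alpha_invariant: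
  assumes w: "w \<in> lists A" "reduced (w @ w)" and w': "w' \<in> lists A" "reduced (w' @ w')"
    and inv: "invariant w = invariant w'"
    and i\<^sub>U: "i\<^sub>U \<in> Q\<^sub>U" and U: "U = val ` {u \<in> lists A. foldl \<delta>\<^sub>U i\<^sub>U u \<in> F\<^sub>U}"
    and i\<^sub>V: "i\<^sub>V \<in> Q\<^sub>V" and V: "V = val ` {u \<in> lists A. foldl \<delta>\<^sub>V i\<^sub>V u \<in> F\<^sub>V}"
    and mem: "val w \<in> alpha G U V"
  shows "val w' \<in> alpha G U V"
proof (cases "w = []")
  case True
  then have "w' = []" using invariant_eqD(2)[OF inv] by simp
  then show ?thesis using True mem by simp
next
  case False
  have "reduced w" "reduced w'" using w w' by (auto simp: reduced_append_iff)
  then have split: "split_profiles w = split_profiles w'" using invariant_eqD(6)[OF inv] by simp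
  obtain u v where uv: "u \<in> U" "v \<in> V" "val w = inv v \<otimes> u \<otimes> v"
    using mem unfolding alpha_def by (elim UN_E imageE)
  have cl: "u \<in> carrier G" "v \<in> carrier G" using uv U V by auto
  obtain r where r: "r \<in> lists A" "reduced r" "val r = v" using carrier_reduced cl by blast
  obtain q p s n where d: "w = q @ p" "s \<in> lists A" "reduced (s @ p @ q @ winv s)"
    "r = s @ p @ wpow n w \<or> r = s @ winv q @ wpow n (winv w)"
    using reduced_conj_decomp[OF False w r(1,2)] .
  have l: "q \<in> lists A" "p \<in> lists A" using d(1) w by auto
  have "(profile q, profile p) \<in> split_profiles w"
    unfolding split_profiles_def by (intro CollectI exI conjI, rule refl, rule d(1))
  then obtain q' p' where d': "w' = q' @ p'" and pr: "profile q = profile q'" "profile p = profile p'"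
    unfolding split unfolding split_profiles_def by (elim CollectE exE conjE Pair_inject)
  have l': "q' \<in> lists A" "p' \<in> lists A" using d' w' by auto
  have eq: "run\<^sub>U q = run\<^sub>U q'" "run\<^sub>U p = run\<^sub>U p'" "run\<^sub>V q = run\<^sub>V q'" "run\<^sub>V p = run\<^sub>V p'"
    "run\<^sub>V (winv q) = run\<^sub>V (winv q')" "run\<^sub>V (winv p) = run\<^sub>V (winv p')"
    using pr unfolding profile_def by simp_all
  note app_U = complete_automaton.run_rel_append[OF aut_U]
  note app_V = complete_automaton.run_rel_append[OF aut_V]
  have eq_w: "run\<^sub>V w = run\<^sub>V w'" "run\<^sub>V (winv w) = run\<^sub>V (winv w')"
    using \<open>reduced w\<close> \<open>reduced w'\<close> reduced_winv[OF w(1)] reduced_winv[OF w'(1)] d(1) d' l l' eq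
    by (simp_all add: app_V)

  define c where "c = s @ p @ q @ winv s"
  define c' where "c' = s @ p' @ q' @ winv s"
  have c: "c \<in> lists A" "c' \<in> lists A" using l l' d(2) by (auto simp: c_def c'_def)
  \<comment> \<open>The given \<open>u\<close> is the value of the reduced word
    \<open>c\<close>.\<close>
  have "u = v \<otimes> val w \<otimes> inv v"
    using cl uv(3) by (simp add: m_assoc) (simp add: m_assoc[symmetric])
  also have "val w = inv v \<otimes> val c \<otimes> v"
    using val_conj_decomp[OF d(1) l d(2,4)] r by (simp add: c_def)
  also have "v \<otimes> (inv v \<otimes> val c \<otimes> v) \<otimes> inv v = val c"
    using cl c by (simp add: m_assoc) (simp add: m_assoc[symmetric])
  finally have c_U: "val c \<in> U" using uv by simp
  \<comment> \<open>The action of the reduced word \<open>c\<close> is exactly the composite of the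
    actions of its factors. As \<open>c'\<close> may fail to be reduced, only an inclusion results,
    which is enough for membership.\<close>
  have sub: "run\<^sub>U c \<subseteq> run\<^sub>U c'"
  proof -
    have "reduced (p @ q @ winv s)" "reduced (q @ winv s)"
      using d(3) by (auto simp: reduced_append_iff)
    then have "run\<^sub>U c = run\<^sub>U s O run\<^sub>U p O run\<^sub>U q O run\<^sub>U (winv s)"
      using d(2,3) l by (simp add: c_def app_U)
    also have "\<dots> \<subseteq> run\<^sub>U c'"
      unfolding eq c'_def using run_rel_append_superset d(2) l'
      by (intro order_trans[OF _ run_rel_append_superset] relcomp_mono order_refl) auto
    finally show ?thesis .
  qed
  have c'_U: "val c' \<in> U"
    unfolding U by (rule val_in_rational_mono[OF i\<^sub>U c sub c_U[unfolded U]])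

  have "\<exists>r' \<in> lists A. val r' \<in> V \<and>
    (r' = s @ p' @ wpow n w' \<or> r' = s @ winv q' @ wpow n (winv w'))"
  proof -
    \<comment> \<open>Both shapes of \<open>r\<close> are covered: \<open>t\<close> and
      \<open>z\<close> are \<open>p\<close> and \<open>w\<close>, or \<open>winv q\<close> and
      \<open>winv w\<close>. Since \<open>r\<close> is reduced its action factors exactly, whatever
      the exponent \<open>n\<close>.\<close>
    have V_transfer: "val (s @ t' @ wpow n z') \<in> V"
      if t: "t \<in> lists A" "t' \<in> lists A" "run\<^sub>V t = run\<^sub>V t'"
        and z: "z \<in> lists A" "z' \<in> lists A" "run\<^sub>V z = run\<^sub>V z'"
        and r_eq: "r = s @ t @ wpow n z" for t t' z z'
    proof -
      have red: "reduced ((s @ t) @ wpow n z)" "reduced (s @ t)"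
        using r(2) r_eq by (auto simp: reduced_append_iff)
      have "run\<^sub>V r = (run\<^sub>V s O run\<^sub>V t) O (run\<^sub>V z ^^ n)"
        using complete_automaton.run_rel_wpow[OF aut_V _ _ red(1)] app_V[OF _ _ red(2)] r_eq d(2) t z
        by simp
      also have "\<dots> \<subseteq> run\<^sub>V (s @ t') O (run\<^sub>V z' ^^ n)"
        unfolding t z using run_rel_append_superset d(2) t by (intro relcomp_mono) auto
      also have "\<dots> \<subseteq> run\<^sub>V ((s @ t') @ wpow n z')"
        using d(2) t z by (intro run_rel_wpow_superset) auto
      finally have sub: "run\<^sub>V r \<subseteq> run\<^sub>V (s @ t' @ wpow n z')" by simp
      have "val r \<in> V" unfolding r(3) by (rule uv(2))
      moreover have "s @ t' @ wpow n z' \<in> lists A" using d(2) t z by simp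
      ultimately show ?thesis unfolding V by (rule val_in_rational_mono[OF i\<^sub>V r(1) _ sub, rotated])
    qed
    from d(4) show ?thesis
    proof
      assume "r = s @ p @ wpow n w"
      then have "val (s @ p' @ wpow n w') \<in> V" 
        by (rule V_transfer[OF l(2) l'(2) eq(4) w(1) w'(1) eq_w(1)])
      then show ?thesis using d(2) l' w' by (intro bexI[of _ "s @ p' @ wpow n w'"]) auto
    next
      assume "r = s @ winv q @ wpow n (winv w)"
      then have "val (s @ winv q' @ wpow n (winv w')) \<in> V"
        by (rule V_transfer[OF winv_lists[OF l(1)] winv_lists[OF l'(1)] eq(5)
          winv_lists[OF w(1)] winv_lists[OF w'(1)] eq_w(2)])
      then show ?thesis
        using d(2) l' w' by (intro bexI[of _ "s @ winv q' @ wpow n (winv w')"]) auto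
    qed
  qed
  then obtain r' where r': "r' \<in> lists A" "val r' \<in> V"
    "r' = s @ p' @ wpow n w' \<or> r' = s @ winv q' @ wpow n (winv w')" by blast
  have "val w' = inv (val r') \<otimes> val c' \<otimes> val r'"
    using val_conj_decomp[OF d' l' d(2) r'(3)] by (simp add: c'_def)
  then show ?thesis unfolding alpha_def using c'_U r'(2) by blast
qed

end

section \<open>Regularity of both languages\<close>

theorem theorem4p5:
  fixes G :: "('a, 'b) monoid_scheme" and X U V :: "'a set" and R :: "'a rel"
  assumes "finite X"
    and "free_group_basis G X"
    and "linear_order_on (sym_gens G X) R"
    and "rational_subset G X U"
    and "rational_subset G X V"
  shows "regular_language (sym_gens G X) (ConjGeo G X U V) \<and>
    regular_language (sym_gens G X) (ConjMinLenSL G X R U V)"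
proof -
  interpret group G using assms(2) by (simp add: free_group_basis_def)
  interpret free_group_with_basis G X by unfold_locales (rule assms(2))
  have A: "finite A" using assms(1) by (simp add: sym_gens_def)
  obtain Q\<^sub>U \<delta>\<^sub>U i\<^sub>U F\<^sub>U where U: "complete_automaton G X Q\<^sub>U \<delta>\<^sub>U" "i\<^sub>U \<in> Q\<^sub>U"
    "U = val ` {w \<in> lists A. foldl \<delta>\<^sub>U i\<^sub>U w \<in> F\<^sub>U}"
    using rational_subset_automaton[OF assms(4)] .
  obtain Q\<^sub>V \<delta>\<^sub>V i\<^sub>V F\<^sub>V where V: "complete_automaton G X Q\<^sub>V \<delta>\<^sub>V" "i\<^sub>V \<in> Q\<^sub>V"
    "V = val ` {w \<in> lists A. foldl \<delta>\<^sub>V i\<^sub>V w \<in> F\<^sub>V}"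
    using rational_subset_automaton[OF assms(5)] .
  interpret automaton_pair G X Q\<^sub>U Q\<^sub>V \<delta>\<^sub>U \<delta>\<^sub>V
    by (intro automaton_pair.intro automaton_pair_axioms.intro free_group_with_basis_axioms U(1) V(1))
  have "regular_language A (ConjGeo G X U V)"
  proof (rule regular_language_finite_invariant[where f = invariant])
    fix w w' assume w: "w \<in> ConjGeo G X U V" and w': "w' \<in> lists A" "invariant w = invariant w'"
    then have l: "w \<in> lists A" "reduced (w @ w)" "val w \<in> alpha G U V" by (auto simp: ConjGeo_eq)
    then have "reduced w" by (simp add: reduced_append_iff)
    \<comment> \<open>For a reduced word, cyclic reducedness depends only on emptiness and the first
      and last letters, all of which the invariant records.\<close>
    from invariant_eqD[OF w'(2) this] have "reduced (w' @ w')"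
      using l(2) by (auto simp: reduced_append_iff)
    then show "w' \<in> ConjGeo G X U V"
      using alpha_invariant[OF l(1,2) w'(1) _ w'(2) U(2,3) V(2,3) l(3)] w'(1)
      by (simp add: ConjGeo_eq)
  next
    show "ConjGeo G X U V \<subseteq> lists A" by (auto simp: ConjGeo_eq)
  qed (rule A finite_invariant[OF A] invariant_snoc; assumption)+
  moreover have "U \<subseteq> carrier G" "V \<subseteq> carrier G" using U(3) V(3) by auto
  ultimately show ?thesis using ConjMinLenSL_eq_ConjGeo by simp
qed

end
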